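(* Let $n, m \in \mathbb{N}$ and let $s_1, \dots, s_n$ be positive integers with $s_i \le 2^m$ for all $i$. Let $p_1 < \dots < p_q$ be all the distinct primes dividing at least one of the $s_i$, write $s_i = \prod_{k=1}^q p_k^{\alpha_{ik}}$ with $\alpha_{ik} \in \mathbb{Z}_{\ge 0}$, and let $S_M = (\alpha_{ik})_{1\le i\le n,\,1\le k\le q}$ be the $n \times q$ matrix of exponents. Then there exists a set $\mathcal{C} \subseteq \{1,\dots,n\}$ with $$\prod_{i \in \mathcal{C}} s_i = \prod_{i \in \{1,\dots,n\}\setminus \mathcal{C}} s_i$$ if and only if there exists $x \in \{0,1\}^n$ such that $$\left(x - \tfrac{1}{2}\, 1_{n\times 1}\right)^T S_M = 0_{1\times q}.$$
   Context: $\mathbb{N}$ denotes the positive integers. $1_{n\times 1}$ is the column vector of length $n$ with all entries $1$, and $0_{1\times q}$ is the zero row vector of length $q$. Empty products equal $1$. The first condition is the Product Partition Problem (PPP) for $s_1,\dots,s_n$. *)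

theory Defs
  imports
    "HOL-Computational_Algebra.Primes"
    "Jordan_Normal_Form.Matrix"
begin

text \<open>
  Families \<open>s\<^sub>1, \<dots>, s\<^sub>n\<close> and \<open>p\<^sub>1, \<dots>, p\<^sub>q\<close> are indexed from 1, whereas the entries of a \<open>mat\<close>
  are indexed from 0; hence the shift below.
\<close>

definition exponent_mat :: "nat \<Rightarrow> nat \<Rightarrow> (nat \<Rightarrow> nat \<Rightarrow> nat) \<Rightarrow> real mat" where
  "exponent_mat n q \<alpha> = mat n q (\<lambda>(i, k). real (\<alpha> (Suc i) (Suc k)))"

definition ones_mat :: "nat \<Rightarrow> nat \<Rightarrow> real mat" where
  "ones_mat r c = mat r c (\<lambda>_. 1)"

end

theory Submission
  imports Defs
begin

text \<open>
  Take \<open>x\<close> to be the indicator vector of \<open>C\<close>. The \<open>k\<close>-th entry of \<open>(x - 1/2)\<^sup>T S\<^sub>M\<close> is then half the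
  difference between the exponents of \<open>p\<^sub>k\<close> in the product over \<open>C\<close> and in the complementary product,
  so it vanishes for all \<open>k\<close> iff the two products agree, by unique factorization.
\<close>

text \<open>The exponent of \<open>p j\<close> is recovered from the product as the multiplicity of
  that prime, so equal products force equal exponents. Injectivity keeps two indices from
  contributing to the same prime.\<close>

lemma prod_prime_powers_eq_iff:
  fixes p :: "'b \<Rightarrow> nat"
  assumes "finite K" "inj_on p K" "\<And>k. k \<in> K \<Longrightarrow> prime (p k)"
  shows "(\<Prod>k\<in>K. p k ^ a k) = (\<Prod>k\<in>K. p k ^ b k) \<longleftrightarrow> (\<forall>k\<in>K. a k = b k)"
proof
  have mult: "multiplicity (p j) (\<Prod>k\<in>K. p k ^ c k) = c j" if "j \<in> K" for c :: "'b \<Rightarrow> nat" and j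
  proof -
    \<comment> \<open>\<open>multiplicity_prod_prime_powers\<close> concerns products indexed by the
      primes themselves, so \<open>K\<close> is replaced by its image under \<open>p\<close>, with
      \<open>inv_into\<close> recovering the exponent.\<close>
    have "(\<Prod>k\<in>K. p k ^ c k) = (\<Prod>r\<in>p ` K. r ^ c (inv_into K p r))"
      using assms(2) by (simp add: prod.reindex)
    then show ?thesis
      using assms that multiplicity_prod_prime_powers[of "p ` K" "p j" "\<lambda>r. c (inv_into K p r)"]
      by auto
  qed
  show "\<forall>k\<in>K. a k = b k" if "(\<Prod>k\<in>K. p k ^ a k) = (\<Prod>k\<in>K. p k ^ b k)"
  proof
    fix k
    assume "k \<in> K"
    then show "a k = b k"
      using mult[of k a] mult[of k b] unfolding that by metis
  qed
qed (auto intro: prod.cong)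

text \<open>The coefficient is 1/2 on \<open>C\<close> and -1/2 on the rest of
  \<open>A\<close>.\<close>

lemma sum_indicator_minus_half:
  fixes f :: "'a \<Rightarrow> real"
  assumes "finite A" "C \<subseteq> A"
  shows "(\<Sum>i\<in>A. (of_bool (i \<in> C) - 1 / 2) * f i) = (sum f C - sum f (A - C)) / 2"
proof -
  have "(\<Sum>i\<in>A. (of_bool (i \<in> C) - 1 / 2) * f i) =
      (\<Sum>i\<in>A - C. (of_bool (i \<in> C) - 1 / 2) * f i) + (\<Sum>i\<in>C. (of_bool (i \<in> C) - 1 / 2) * f i)"
    using assms by (rule sum.subset_diff[rotated])
  also have "\<dots> = (\<Sum>i\<in>A - C. - f i / 2) + (\<Sum>i\<in>C. f i / 2)"
    by (intro arg_cong2[of _ _ _ _ "(+)"] sum.cong) auto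
  also have "\<dots> = (sum f C - sum f (A - C)) / 2"
    by (simp add: sum_negf sum_divide_distrib[symmetric] diff_divide_distrib)
  finally show ?thesis .
qed

text \<open>\<open>Suc i\<close> matches the shift in \<open>exponent_mat\<close>: row 0 stands for
  the index 1.\<close>

definition indicator_mat :: "nat \<Rightarrow> nat set \<Rightarrow> real mat" where
  "indicator_mat n C = mat n 1 (\<lambda>(i, _). of_bool (Suc i \<in> C))"

text \<open>Needed for the passage from vectors back to sets: a solution \<open>x\<close> of the
  matrix equation always arises from a subset.\<close>

lemma zero_one_mat_eq_indicator_mat:
  assumes "x \<in> carrier_mat n 1" "elements_mat x \<subseteq> {0, 1}"
  shows "x = indicator_mat n {i \<in> {1..n}. x $$ (i - 1, 0) = 1}"
proof (rule eq_matI)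
  fix i j
  assume "i < dim_row (indicator_mat n {i \<in> {1..n}. x $$ (i - 1, 0) = 1})"
    and "j < dim_col (indicator_mat n {i \<in> {1..n}. x $$ (i - 1, 0) = 1})"
  then have ij: "i < n" "j = 0"
    by (simp_all add: indicator_mat_def)
  then have "x $$ (i, 0) \<in> elements_mat x"
    using elements_matI[OF assms(1) _ _ refl] by simp
  with assms(2) have "x $$ (i, 0) \<in> {0, 1}"
    by (rule subsetD)
  with ij show "x $$ (i, j) = indicator_mat n {i \<in> {1..n}. x $$ (i - 1, 0) = 1} $$ (i, j)"
    by (auto simp: indicator_mat_def)
qed (use assms in \<open>simp_all add: indicator_mat_def\<close>)

text \<open>The linear algebra half of the argument, for an arbitrary array \<open>\<alpha>\<close>;
  unique factorization enters only through \<open>prod_prime_powers_eq_iff\<close>.\<close>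

lemma indicator_mat_equation_iff:
  assumes "C \<subseteq> {1..n}"
  shows "transpose_mat (indicator_mat n C - (1 / 2) \<cdot>\<^sub>m ones_mat n 1) * exponent_mat n q \<alpha> = 0\<^sub>m 1 q
    \<longleftrightarrow> (\<forall>k\<in>{1..q}. (\<Sum>i\<in>C. \<alpha> i k) = (\<Sum>i\<in>{1..n} - C. \<alpha> i k))"
    (is "?M = _ \<longleftrightarrow> _")
proof -
  have entry: "?M $$ (0, k) =
      (real (\<Sum>i\<in>C. \<alpha> i (Suc k)) - real (\<Sum>i\<in>{1..n} - C. \<alpha> i (Suc k))) / 2" if "k < q" for k
  proof -
    have "?M $$ (0, k) = (\<Sum>i<n. (of_bool (Suc i \<in> C) - 1 / 2) * real (\<alpha> (Suc i) (Suc k)))"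
      using that by (simp add: indicator_mat_def ones_mat_def exponent_mat_def scalar_prod_def
          lessThan_atLeast0)
    also have "\<dots> = (\<Sum>i\<in>{1..n}. (of_bool (i \<in> C) - 1 / 2) * real (\<alpha> i (Suc k)))"
      by (simp add: sum.atLeast1_atMost_eq)
    finally show ?thesis
      using sum_indicator_minus_half[OF _ assms, of "\<lambda>i. real (\<alpha> i (Suc k))"] by simp
  qed
  have entry_eq_0: "?M $$ (0, k) = 0 \<longleftrightarrow> (\<Sum>i\<in>C. \<alpha> i (Suc k)) = (\<Sum>i\<in>{1..n} - C. \<alpha> i (Suc k))"
    if "k < q" for k
    \<comment> \<open>Without \<open>of_nat_sum\<close> each sum stays under a single
      \<open>real\<close>, so the equation descends to the naturals by injectivity of the
      cast.\<close>
    unfolding entry[OF that] by (simp del: of_nat_sum)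
  have dim: "dim_row ?M = 1" "dim_col ?M = q"
    by (simp_all add: ones_mat_def exponent_mat_def)
  have "?M = 0\<^sub>m 1 q \<longleftrightarrow> (\<forall>k<q. ?M $$ (0, k) = 0)"
    unfolding mat_eq_iff dim by (simp del: index_mult_mat)
  also have "\<dots> \<longleftrightarrow> (\<forall>k<q. (\<Sum>i\<in>C. \<alpha> i (Suc k)) = (\<Sum>i\<in>{1..n} - C. \<alpha> i (Suc k)))"
    using entry_eq_0 by blast
  also have "\<dots> \<longleftrightarrow> (\<forall>k\<in>Suc ` {..<q}. (\<Sum>i\<in>C. \<alpha> i k) = (\<Sum>i\<in>{1..n} - C. \<alpha> i k))"
    by auto
  finally show ?thesis
    by (simp only: image_Suc_lessThan)
qed

theorem lemma2p2:
  fixes n m q :: nat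
    and s p :: "nat \<Rightarrow> nat"
    and \<alpha> :: "nat \<Rightarrow> nat \<Rightarrow> nat"
  assumes "n \<ge> 1" and "m \<ge> 1"
    and s: "\<And>i. i \<in> {1..n} \<Longrightarrow> 0 < s i \<and> s i \<le> 2 ^ m"
    and p_mono: "strict_mono_on {1..q} p"
    and p_primes: "p ` {1..q} = {r. prime r \<and> (\<exists>i\<in>{1..n}. r dvd s i)}"
    and factorization: "\<And>i. i \<in> {1..n} \<Longrightarrow> s i = (\<Prod>k = 1..q. p k ^ \<alpha> i k)"
  shows "(\<exists>C \<subseteq> {1..n}. (\<Prod>i\<in>C. s i) = (\<Prod>i\<in>{1..n} - C. s i)) \<longleftrightarrow>
    (\<exists>x \<in> carrier_mat n 1. elements_mat x \<subseteq> {0, 1} \<and>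
       transpose_mat (x - (1 / 2) \<cdot>\<^sub>m ones_mat n 1) * exponent_mat n q \<alpha> = 0\<^sub>m 1 q)"
    (is "?partition \<longleftrightarrow> (\<exists>x \<in> carrier_mat n 1. elements_mat x \<subseteq> {0, 1} \<and> ?eq x)")
proof -
  \<comment> \<open>Swapping the two products collects, for each prime, its exponents over
    \<open>D\<close>.\<close>
  have prod_s: "(\<Prod>i\<in>D. s i) = (\<Prod>k = 1..q. p k ^ (\<Sum>i\<in>D. \<alpha> i k))" if "D \<subseteq> {1..n}" for D
  proof -
    have "(\<Prod>i\<in>D. s i) = (\<Prod>i\<in>D. \<Prod>k = 1..q. p k ^ \<alpha> i k)"
      using that factorization by (intro prod.cong) auto
    also have "\<dots> = (\<Prod>k = 1..q. \<Prod>i\<in>D. p k ^ \<alpha> i k)"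
      by (rule prod.swap)
    finally show ?thesis
      by (simp add: power_sum)
  qed
  have "prime (p k)" if "k \<in> {1..q}" for k
    using that p_primes by blast
  \<comment> \<open>Both sides say that the exponent sums over \<open>C\<close> and over its
    complement agree for every \<open>k\<close>.\<close>
  then have eq_iff: "(\<Prod>i\<in>C. s i) = (\<Prod>i\<in>{1..n} - C. s i) \<longleftrightarrow> ?eq (indicator_mat n C)"
    if "C \<subseteq> {1..n}" for C
    using that strict_mono_on_imp_inj_on[OF p_mono]
    by (simp only: prod_s[OF that] prod_s[OF Diff_subset] indicator_mat_equation_iff
        prod_prime_powers_eq_iff[OF finite_atLeastAtMost])
  have carrier: "indicator_mat n C \<in> carrier_mat n 1" "elements_mat (indicator_mat n C) \<subseteq> {0, 1}" for C
    by (auto simp: indicator_mat_def elements_mat_def)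
  show ?thesis
  proof
    assume ?partition
    then show "\<exists>x \<in> carrier_mat n 1. elements_mat x \<subseteq> {0, 1} \<and> ?eq x"
      using eq_iff carrier by blast
  next
    assume "\<exists>x \<in> carrier_mat n 1. elements_mat x \<subseteq> {0, 1} \<and> ?eq x"
    then obtain x where x: "x \<in> carrier_mat n 1" "elements_mat x \<subseteq> {0, 1}" "?eq x"
      by blast
    \<comment> \<open>\<open>i - 1\<close> undoes the shift in \<open>indicator_mat\<close>; since
      \<open>i\<close> is at least 1, truncated subtraction loses nothing.\<close>
    let ?C = "{i \<in> {1..n}. x $$ (i - 1, 0) = 1}"
    have "?eq (indicator_mat n ?C)"
      using x(3) unfolding zero_one_mat_eq_indicator_mat[OF x(1,2), symmetric] .
    moreover have "?C \<subseteq> {1..n}"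
      by blast
    ultimately show ?partition
      using eq_iff by blast
  qed
qed

end
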